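(* Let $(\mathfrak g_0,[\cdot,\cdot]_0,J_0,\varphi_0)$ be a pseudo-Hermitian quadratic Lie algebra. Let $D,F$ be two $\varphi_0$-skewsymmetric derivations of $\mathfrak g_0$ such that $[F+J_0D,J_0]=0$ and $[F,D]=\mathrm{ad}_{\mathfrak g_0}(s_0)$ for a certain $s_0\in\mathfrak g_0$ (commutators of linear endomorphisms). Define the vector space $\mathfrak g$ as the direct sum of $\mathfrak g_0$ and a $4$-dimensional space with basis $\{z,z',v,v'\}$: $$\mathfrak g=\mathbb Rz\oplus\mathbb Rz'\oplus\mathfrak g_0\oplus\mathbb Rv'\oplus\mathbb Rv.$$ Define on $\mathfrak g$ a skewsymmetric bilinear product $[\cdot,\cdot]$ and a symmetric bilinear form $\varphi$ by the following nonzero pairings, for all $x,y\in\mathfrak g_0$: $$[v,v']=s_0,\quad [v,x]=Fx-\varphi_0(s_0,x)z',\quad [v',x]=Dx+\varphi_0(s_0,x)z,$$ $$[x,y]=[x,y]_0+\varphi_0(Dx,y)z'+\varphi_0(Fx,y)z,$$ $$\varphi(z,v)=\varphi(z',v')=1,\quad \varphi(x,y)=\varphi_0(x,y).$$ Let also $J\in\mathfrak{gl}(\mathfrak g)$ be defined by $Jz=z'$, $Jz'=-z$, $Jv=v'$, $Jv'=-v$, and $Jx=J_0x$ for all $x\in\mathfrak g_0$. Then the triple $(\mathfrak g,[\cdot,\cdot],\varphi)$ is a quadratic Lie algebra, $J$ is a complex structure on $\mathfrak g$, and $\varphi$ is pseudo-Hermitian, i.e. $\varphi(JX,JY)=\varphi(X,Y)$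 for all $X,Y\in\mathfrak g$.
   Context: All Lie algebras are real. A complex structure on a Lie algebra $\mathfrak g$ is a linear map $J:\mathfrak g\to\mathfrak g$ with $J^2=-I$ and $[x,y]+J[Jx,y]+J[x,Jy]-[Jx,Jy]=0$ for all $x,y\in\mathfrak g$. A quadratic Lie algebra is a Lie algebra with a non-degenerate symmetric bilinear form $\varphi$ such that $\varphi([x,y],z)+\varphi(y,[x,z])=0$ for all $x,y,z$. A pseudo-Hermitian quadratic Lie algebra is a quadratic Lie algebra $(\mathfrak g,\varphi)$ with a complex structure $J$ such that $\varphi(Jx,Jy)=\varphi(x,y)$ for all $x,y$. A linear map $A$ is $\varphi_0$-skewsymmetric if $\varphi_0(Ax,y)=-\varphi_0(x,Ay)$ for all $x,y$. *)

theory Defs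
  imports "HOL-Analysis.Analysis"
begin

text \<open>
  A real vector space is a type of class \<^class>\<open>real_vector\<close>; no topology is used and no
  finite-dimensionality is assumed. A bracket is a curried binary operation.
\<close>

definition lie_algebra :: "('a::real_vector \<Rightarrow> 'a \<Rightarrow> 'a) \<Rightarrow> bool" where
  "lie_algebra br \<longleftrightarrow>
     bilinear br \<and>
     (\<forall>x y. br x y = - br y x) \<and>
     (\<forall>x y w. br x (br y w) + br y (br w x) + br w (br x y) = 0)"

definition nondegenerate :: "('a::real_vector \<Rightarrow> 'a \<Rightarrow> real) \<Rightarrow> bool" where
  "nondegenerate \<phi> \<longleftrightarrow> (\<forall>x. (\<forall>y. \<phi> x y = 0) \<longrightarrow> x = 0)"

definition quadratic_lie_algebra ::
  "('a::real_vector \<Rightarrow> 'a \<Rightarrow> 'a) \<Rightarrow> ('a \<Rightarrow> 'a \<Rightarrow> real) \<Rightarrow> bool" where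
  "quadratic_lie_algebra br \<phi> \<longleftrightarrow>
     lie_algebra br \<and> bilinear \<phi> \<and> (\<forall>x y. \<phi> x y = \<phi> y x) \<and> nondegenerate \<phi> \<and>
     (\<forall>x y w. \<phi> (br x y) w + \<phi> y (br x w) = 0)"

definition complex_structure ::
  "('a::real_vector \<Rightarrow> 'a \<Rightarrow> 'a) \<Rightarrow> ('a \<Rightarrow> 'a) \<Rightarrow> bool" where
  "complex_structure br J \<longleftrightarrow>
     linear J \<and> (\<forall>x. J (J x) = - x) \<and>
     (\<forall>x y. br x y + J (br (J x) y) + J (br x (J y)) - br (J x) (J y) = 0)"

definition pseudo_hermitian_quadratic_lie_algebra ::
  "('a::real_vector \<Rightarrow> 'a \<Rightarrow> 'a) \<Rightarrow> ('a \<Rightarrow> 'a) \<Rightarrow> ('a \<Rightarrow> 'a \<Rightarrow> real) \<Rightarrow> bool" where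
  "pseudo_hermitian_quadratic_lie_algebra br J \<phi> \<longleftrightarrow>
     quadratic_lie_algebra br \<phi> \<and> complex_structure br J \<and> (\<forall>x y. \<phi> (J x) (J y) = \<phi> x y)"

definition derivation :: "('a::real_vector \<Rightarrow> 'a \<Rightarrow> 'a) \<Rightarrow> ('a \<Rightarrow> 'a) \<Rightarrow> bool" where
  "derivation br D \<longleftrightarrow> linear D \<and> (\<forall>x y. D (br x y) = br (D x) y + br x (D y))"

definition skewsymmetric_wrt ::
  "('a::real_vector \<Rightarrow> 'a \<Rightarrow> real) \<Rightarrow> ('a \<Rightarrow> 'a) \<Rightarrow> bool" where
  "skewsymmetric_wrt \<phi> A \<longleftrightarrow> linear A \<and> (\<forall>x y. \<phi> (A x) y = - \<phi> x (A y))"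

definition commutator :: "('a::real_vector \<Rightarrow> 'a) \<Rightarrow> ('a \<Rightarrow> 'a) \<Rightarrow> 'a \<Rightarrow> 'a" where
  "commutator A B = (\<lambda>x. A (B x) - B (A x))"

definition ad :: "('a::real_vector \<Rightarrow> 'a \<Rightarrow> 'a) \<Rightarrow> 'a \<Rightarrow> 'a \<Rightarrow> 'a" where
  "ad br s = (\<lambda>x. br s x)"

text \<open>
  The tuple \<open>(a, a', x, b', b)\<close> stands for \<open>a z + a' z' + x + b' v' + b v\<close>.
\<close>

type_synonym 'a ext = "real \<times> real \<times> 'a \<times> real \<times> real"

definition vec_z :: "'a::real_vector ext" where "vec_z = (1, 0, 0, 0, 0)"
definition vec_z' :: "'a::real_vector ext" where "vec_z' = (0, 1, 0, 0, 0)"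
definition vec_v' :: "'a::real_vector ext" where "vec_v' = (0, 0, 0, 1, 0)"
definition vec_v :: "'a::real_vector ext" where "vec_v = (0, 0, 0, 0, 1)"
definition emb :: "'a::real_vector \<Rightarrow> 'a ext" where "emb x = (0, 0, x, 0, 0)"

lemma ext_decomp:
  "(a, a', x, b', b) =
    a *\<^sub>R vec_z + a' *\<^sub>R vec_z' + emb x + b' *\<^sub>R vec_v' + b *\<^sub>R (vec_v :: 'a::real_vector ext)"
  by (simp add: vec_z_def vec_z'_def vec_v'_def vec_v_def emb_def)

fun ext_bracket ::
  "('a::real_vector \<Rightarrow> 'a \<Rightarrow> 'a) \<Rightarrow> ('a \<Rightarrow> 'a \<Rightarrow> real) \<Rightarrow> ('a \<Rightarrow> 'a) \<Rightarrow> ('a \<Rightarrow> 'a) \<Rightarrow> 'a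
    \<Rightarrow> 'a ext \<Rightarrow> 'a ext \<Rightarrow> 'a ext" where
  "ext_bracket br0 \<phi>0 D F s0 (a, a', x, b', b) (c, c', y, d', d) =
     (\<phi>0 (F x) y + b' * \<phi>0 s0 y - d' * \<phi>0 s0 x,
      \<phi>0 (D x) y - b * \<phi>0 s0 y + d * \<phi>0 s0 x,
      br0 x y + b *\<^sub>R F y - d *\<^sub>R F x + b' *\<^sub>R D y - d' *\<^sub>R D x + (b * d' - b' * d) *\<^sub>R s0,
      0,
      0)"

fun ext_form :: "('a::real_vector \<Rightarrow> 'a \<Rightarrow> real) \<Rightarrow> 'a ext \<Rightarrow> 'a ext \<Rightarrow> real" where
  "ext_form \<phi>0 (a, a', x, b', b) (c, c', y, d', d) =
     a * d + b * c + a' * d' + b' * c' + \<phi>0 x y"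

fun ext_J :: "('a::real_vector \<Rightarrow> 'a) \<Rightarrow> 'a ext \<Rightarrow> 'a ext" where
  "ext_J J0 (a, a', x, b', b) = (- a', a, J0 x, b, - b')"

text \<open>
  The coordinate formulas define exactly the bilinear (resp. linear) maps prescribed on \<open>z, z', v, v'\<close> and \<open>g\<^sub>0\<close>, pairings that are not listed being zero.
\<close>

definition ext_bracket_pairings ::
  "('a::real_vector \<Rightarrow> 'a \<Rightarrow> 'a) \<Rightarrow> ('a \<Rightarrow> 'a \<Rightarrow> real) \<Rightarrow> ('a \<Rightarrow> 'a) \<Rightarrow> ('a \<Rightarrow> 'a) \<Rightarrow> 'a
    \<Rightarrow> ('a ext \<Rightarrow> 'a ext \<Rightarrow> 'a ext) \<Rightarrow> bool" where
  "ext_bracket_pairings br0 \<phi>0 D F s0 B \<longleftrightarrow>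
     B vec_v vec_v' = emb s0 \<and>
     (\<forall>x. B vec_v (emb x) = emb (F x) - \<phi>0 s0 x *\<^sub>R vec_z') \<and>
     (\<forall>x. B vec_v' (emb x) = emb (D x) + \<phi>0 s0 x *\<^sub>R vec_z) \<and>
     (\<forall>x y. B (emb x) (emb y) =
        emb (br0 x y) + \<phi>0 (D x) y *\<^sub>R vec_z' + \<phi>0 (F x) y *\<^sub>R vec_z) \<and>
     (\<forall>X. B vec_z X = 0 \<and> B vec_z' X = 0)"

definition ext_form_pairings ::
  "('a::real_vector \<Rightarrow> 'a \<Rightarrow> real) \<Rightarrow> ('a ext \<Rightarrow> 'a ext \<Rightarrow> real) \<Rightarrow> bool" where
  "ext_form_pairings \<phi>0 \<Phi> \<longleftrightarrow>
     \<Phi> vec_z vec_v = 1 \<and> \<Phi> vec_z' vec_v' = 1 \<and> (\<forall>x y. \<Phi> (emb x) (emb y) = \<phi>0 x y) \<and>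
     \<Phi> vec_z vec_z = 0 \<and> \<Phi> vec_z vec_z' = 0 \<and> \<Phi> vec_z' vec_z' = 0 \<and>
     \<Phi> vec_v vec_v = 0 \<and> \<Phi> vec_v vec_v' = 0 \<and> \<Phi> vec_v' vec_v' = 0 \<and>
     \<Phi> vec_z vec_v' = 0 \<and> \<Phi> vec_z' vec_v = 0 \<and>
     (\<forall>x. \<Phi> vec_z (emb x) = 0 \<and> \<Phi> vec_z' (emb x) = 0 \<and>
          \<Phi> vec_v (emb x) = 0 \<and> \<Phi> vec_v' (emb x) = 0)"

lemma ext_bracket_characterization:
  fixes br0 :: "'a::real_vector \<Rightarrow> 'a \<Rightarrow> 'a"
  assumes "quadratic_lie_algebra br0 \<phi>0"
    and D: "skewsymmetric_wrt \<phi>0 D" and F: "skewsymmetric_wrt \<phi>0 F"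
  shows "bilinear B \<and> (\<forall>X Y. B X Y = - B Y X) \<and> ext_bracket_pairings br0 \<phi>0 D F s0 B
           \<longleftrightarrow> B = ext_bracket br0 \<phi>0 D F s0"
proof
  have linD: "linear D" and linF: "linear F"
    using D F unfolding skewsymmetric_wrt_def by blast+
  have bil: "bilinear \<phi>0" and sym: "\<And>x y. \<phi>0 x y = \<phi>0 y x"
    and bb: "bilinear br0" and sk: "\<And>x y. br0 x y = - br0 y x"
    using assms(1) unfolding quadratic_lie_algebra_def lie_algebra_def by blast+
  have DF: "\<And>x y. \<phi>0 (D x) y = - \<phi>0 (D y) x" "\<And>x y. \<phi>0 (F x) y = - \<phi>0 (F y) x"
    using D F sym unfolding skewsymmetric_wrt_def by metis+
  note lin = bilinear_ladd[OF bil] bilinear_radd[OF bil] bilinear_lmul[OF bil] bilinear_rmul[OF bil]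
    bilinear_ladd[OF bb] bilinear_radd[OF bb] bilinear_lmul[OF bb] bilinear_rmul[OF bb]
    linear_add[OF linD] linear_add[OF linF] linear_scale[OF linD] linear_scale[OF linF]
  note zero = bilinear_lzero[OF bil] bilinear_rzero[OF bil] bilinear_lzero[OF bb] bilinear_rzero[OF bb]
    linear_0[OF linD] linear_0[OF linF]
  show "B = ext_bracket br0 \<phi>0 D F s0"
    if h: "bilinear B \<and> (\<forall>X Y. B X Y = - B Y X) \<and> ext_bracket_pairings br0 \<phi>0 D F s0 B"
  proof (intro ext)
    fix X Y :: "'a ext"
    obtain a a' x b' b where X: "X = (a, a', x, b', b)" by (cases X) auto
    obtain c c' y d' d where Y: "Y = (c, c', y, d', d)" by (cases Y) auto
    have B: "bilinear B" and skew: "\<And>X Y. B X Y = - B Y X"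
      and pr: "B vec_v vec_v' = emb s0" "\<And>x. B vec_v (emb x) = emb (F x) - \<phi>0 s0 x *\<^sub>R vec_z'"
        "\<And>x. B vec_v' (emb x) = emb (D x) + \<phi>0 s0 x *\<^sub>R vec_z"
        "\<And>x y. B (emb x) (emb y) =
            emb (br0 x y) + \<phi>0 (D x) y *\<^sub>R vec_z' + \<phi>0 (F x) y *\<^sub>R vec_z"
        "\<And>X. B vec_z X = 0" "\<And>X. B vec_z' X = 0"
      using h unfolding ext_bracket_pairings_def by blast+
    have self: "B Z Z = 0" for Z
    proof -
      have "B Z Z + B Z Z = 0" using skew[of Z Z] by (metis add.right_inverse)
      then have "2 *\<^sub>R B Z Z = 0" by (simp only: scaleR_2)
      then show ?thesis by simp
    qed
    have pr': "B vec_v' vec_v = - emb s0" "\<And>x. B (emb x) vec_v = - (emb (F x) - \<phi>0 s0 x *\<^sub>R vec_z')"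
        "\<And>x. B (emb x) vec_v' = - (emb (D x) + \<phi>0 s0 x *\<^sub>R vec_z)"
        "\<And>X. B X vec_z = 0" "\<And>X. B X vec_z' = 0"
      using pr skew by (metis, metis, metis, metis minus_zero, metis minus_zero)
    have "B X Y = B (a *\<^sub>R vec_z + a' *\<^sub>R vec_z' + emb x + b' *\<^sub>R vec_v' + b *\<^sub>R vec_v)
                    (c *\<^sub>R vec_z + c' *\<^sub>R vec_z' + emb y + d' *\<^sub>R vec_v' + d *\<^sub>R vec_v)"
      by (simp only: X Y ext_decomp)
    also have "\<dots> = ext_bracket br0 \<phi>0 D F s0 X Y"
      unfolding X Y bilinear_ladd[OF B] bilinear_radd[OF B] bilinear_lmul[OF B] bilinear_rmul[OF B]
        pr pr' self
      by (simp add: vec_z_def vec_z'_def vec_v'_def vec_v_def emb_def algebra_simps)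
    finally show "B X Y = ext_bracket br0 \<phi>0 D F s0 X Y" .
  qed
  show "bilinear B \<and> (\<forall>X Y. B X Y = - B Y X) \<and> ext_bracket_pairings br0 \<phi>0 D F s0 B"
    if B: "B = ext_bracket br0 \<phi>0 D F s0"
  proof (intro conjI allI)
    show "bilinear B"
      unfolding bilinear_def B by (auto intro!: linearI simp: lin algebra_simps)
    show "B X Y = - B Y X" for X Y
    proof -
      obtain a a' x b' b where X: "X = (a, a', x, b', b)" by (cases X) auto
      obtain c c' y d' d where Y: "Y = (c, c', y, d', d)" by (cases Y) auto
      show ?thesis
        unfolding B X Y using sk[of x y] DF(1)[of x y] DF(2)[of x y] by (simp add: algebra_simps)
    qed
    show "ext_bracket_pairings br0 \<phi>0 D F s0 B"
      by (auto simp: B ext_bracket_pairings_def vec_z_def vec_z'_def vec_v'_def vec_v_def emb_def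
          zero zero_prod_def)
  qed
qed

lemma ext_form_characterization:
  fixes \<phi>0 :: "'a::real_vector \<Rightarrow> 'a \<Rightarrow> real"
  assumes "bilinear \<phi>0" "\<And>x y. \<phi>0 x y = \<phi>0 y x"
  shows "bilinear \<Phi> \<and> (\<forall>X Y. \<Phi> X Y = \<Phi> Y X) \<and> ext_form_pairings \<phi>0 \<Phi>
           \<longleftrightarrow> \<Phi> = ext_form \<phi>0"
proof
  note lin = bilinear_ladd[OF assms(1)] bilinear_radd[OF assms(1)]
    bilinear_lmul[OF assms(1)] bilinear_rmul[OF assms(1)]
  show "\<Phi> = ext_form \<phi>0"
    if h: "bilinear \<Phi> \<and> (\<forall>X Y. \<Phi> X Y = \<Phi> Y X) \<and> ext_form_pairings \<phi>0 \<Phi>"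
  proof (intro ext)
    fix X Y :: "'a ext"
    obtain a a' x b' b where X: "X = (a, a', x, b', b)" by (cases X) auto
    obtain c c' y d' d where Y: "Y = (c, c', y, d', d)" by (cases Y) auto
    have B: "bilinear \<Phi>" and sym: "\<And>X Y. \<Phi> X Y = \<Phi> Y X" and pr: "ext_form_pairings \<phi>0 \<Phi>"
      using h by blast+
    note pr1 = pr[unfolded ext_form_pairings_def]
    have pr2: "\<Phi> vec_v vec_z = 1" "\<Phi> vec_v' vec_z' = 1" "\<Phi> vec_z' vec_z = 0" "\<Phi> vec_v' vec_v = 0"
      "\<Phi> vec_v' vec_z = 0" "\<Phi> vec_v vec_z' = 0" "\<And>x. \<Phi> (emb x) vec_z = 0"
      "\<And>x. \<Phi> (emb x) vec_z' = 0" "\<And>x. \<Phi> (emb x) vec_v = 0" "\<And>x. \<Phi> (emb x) vec_v' = 0"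
      using pr1 sym by metis+
    have "\<Phi> X Y = \<Phi> (a *\<^sub>R vec_z + a' *\<^sub>R vec_z' + emb x + b' *\<^sub>R vec_v' + b *\<^sub>R vec_v)
                    (c *\<^sub>R vec_z + c' *\<^sub>R vec_z' + emb y + d' *\<^sub>R vec_v' + d *\<^sub>R vec_v)"
      by (simp only: X Y ext_decomp)
    also have "\<dots> = ext_form \<phi>0 X Y"
      unfolding X Y bilinear_ladd[OF B] bilinear_radd[OF B] bilinear_lmul[OF B] bilinear_rmul[OF B]
      by (simp add: pr1 pr2)
    finally show "\<Phi> X Y = ext_form \<phi>0 X Y" .
  qed
  show "bilinear \<Phi> \<and> (\<forall>X Y. \<Phi> X Y = \<Phi> Y X) \<and> ext_form_pairings \<phi>0 \<Phi>"
    if B: "\<Phi> = ext_form \<phi>0"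
    unfolding B
    by (auto simp: bilinear_def lin algebra_simps assms(2) ext_form_pairings_def
        vec_z_def vec_z'_def vec_v'_def vec_v_def emb_def
        bilinear_lzero[OF assms(1)] bilinear_rzero[OF assms(1)] intro!: linearI)
qed

lemma ext_J_characterization:
  fixes J0 :: "'a::real_vector \<Rightarrow> 'a"
  assumes "linear J0"
  shows "linear K \<and> K vec_z = vec_z' \<and> K vec_z' = - vec_z \<and> K vec_v = vec_v' \<and>
           K vec_v' = - vec_v \<and> (\<forall>x. K (emb x) = emb (J0 x))
           \<longleftrightarrow> K = ext_J J0"
proof
  show "K = ext_J J0"
    if h: "linear K \<and> K vec_z = vec_z' \<and> K vec_z' = - vec_z \<and> K vec_v = vec_v' \<and>
           K vec_v' = - vec_v \<and> (\<forall>x. K (emb x) = emb (J0 x))"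
  proof
    fix X :: "'a ext"
    obtain a a' x b' b where X: "X = (a, a', x, b', b)" by (cases X) auto
    have "K X = K (a *\<^sub>R vec_z + a' *\<^sub>R vec_z' + emb x + b' *\<^sub>R vec_v' + b *\<^sub>R vec_v)"
      by (simp only: X ext_decomp)
    also have "\<dots> = ext_J J0 X"
      using h unfolding X
      by (simp add: linear_add linear_scale)
        (simp add: vec_z_def vec_z'_def vec_v'_def vec_v_def emb_def)
    finally show "K X = ext_J J0 X" .
  qed
  show "linear K \<and> K vec_z = vec_z' \<and> K vec_z' = - vec_z \<and> K vec_v = vec_v' \<and>
           K vec_v' = - vec_v \<and> (\<forall>x. K (emb x) = emb (J0 x))"
    if B: "K = ext_J J0"
    unfolding B
    by (auto intro!: linearI simp: linear_add[OF assms] linear_scale[OF assms] linear_0[OF assms]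
        vec_z_def vec_z'_def vec_v'_def vec_v_def emb_def)
qed

end

theory Submission
  imports Defs
begin

text \<open>
  The algebra \<open>g\<close> is a double extension of \<open>g\<^sub>0\<close> by the plane spanned by \<open>v, v'\<close>, which acts on
  \<open>g\<^sub>0\<close> through \<open>F, D\<close>; this action is a representation only up to the inner derivation
  \<open>[F, D] = ad s\<^sub>0\<close>, and the bracket \<open>[v, v'] = s\<^sub>0\<close> absorbs the defect. The plane spanned by
  \<open>z, z'\<close> is dual to it under \<open>\<phi>\<close>, and the \<open>z\<close>- and \<open>z'\<close>-coordinates of the bracket are
  precisely the ones that invariance of \<open>\<phi>\<close> forces: the \<open>z\<close>-coordinate of \<open>[x, y]\<close> is
  \<open>\<phi>([x, y], v) = \<phi>([v, x], y) = \<phi>\<^sub>0(F x, y)\<close>, and so on.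

  The Jacobi identity in the \<open>g\<^sub>0\<close>-coordinate combines the one of \<open>g\<^sub>0\<close> with the facts that
  \<open>D\<close> and \<open>F\<close> are derivations and that \<open>[F, D] = ad s\<^sub>0\<close>.
  In the \<open>z\<close>- and \<open>z'\<close>-coordinates it holds because \<open>\<phi>\<^sub>0(F x, y)\<close> and
  \<open>\<phi>\<^sub>0(D x, y)\<close> are two-cocycles (lemma \<open>skew_derivation_cocycle\<close>) and because
  \<open>\<phi>\<^sub>0(F x, D y) - \<phi>\<^sub>0(F y, D x) = \<phi>\<^sub>0(s\<^sub>0, [x, y])\<close> (lemma \<open>form_F_D\<close>), which are the same two facts
  transported by \<open>\<phi>\<^sub>0\<close>.

  For \<open>J\<close>, the hypothesis that \<open>F + J\<^sub>0 D\<close> commutes with \<open>J\<^sub>0\<close> is equivalent to the vanishing of the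
  \<open>g\<^sub>0\<close>-coordinate of the Nijenhuis expression of \<open>v\<close> and \<open>x\<close>. Since \<open>J\<^sub>0\<close> is skewsymmetric for
  \<open>\<phi>\<^sub>0\<close>, pairing that identity with \<open>y\<close> gives the vanishing of the \<open>z\<close>- and \<open>z'\<close>-coordinates
  of the Nijenhuis expression of \<open>x\<close> and \<open>y\<close> (lemma \<open>form_Nijenhuis\<close>).
\<close>

section \<open>Skewsymmetric derivations and closed two-forms\<close>

text \<open>
  Moving \<open>A\<close> onto \<open>br y w\<close> in the first term and applying the derivation rule gives two terms,
  which invariance of \<open>\<phi>\<close> turns into the negatives of the other two. In the language of Lie
  algebra cohomology, the two-form \<open>\<phi> (A x) y\<close> is closed.
\<close>

lemma skew_derivation_cocycle:
  assumes quad: "quadratic_lie_algebra br \<phi>"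
    and der: "derivation br A" and skew: "skewsymmetric_wrt \<phi> A"
  shows "\<phi> (A x) (br y w) + \<phi> (A y) (br w x) + \<phi> (A w) (br x y) = 0"
proof -
  have bil: "bilinear \<phi>" and sym: "\<And>x y. \<phi> x y = \<phi> y x"
    and br: "\<And>x y. br x y = - br y x" and inv: "\<And>x y w. \<phi> (br x y) w = - \<phi> y (br x w)"
    using quad unfolding quadratic_lie_algebra_def lie_algebra_def
    by (blast, blast, blast, metis add_eq_0_iff2)
  have A: "A (br x y) = br (A x) y + br x (A y)" for x y
    using der unfolding derivation_def by blast
  have S: "\<phi> (A x) y = - \<phi> x (A y)" for x y
    using skew unfolding skewsymmetric_wrt_def by blast
  have inv': "\<phi> (br x y) w = \<phi> x (br y w)" for x y w
    using inv[of y x w] br[of x y] by (simp add: bilinear_lneg[OF bil])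
  have "\<phi> (A x) (br y w) = - \<phi> x (br (A y) w) - \<phi> x (br y (A w))"
    by (simp add: S A bilinear_radd[OF bil])
  also have "\<phi> x (br (A y) w) = \<phi> (A y) (br w x)"
    using inv'[of "A y" w x] sym by metis
  also have "\<phi> x (br y (A w)) = \<phi> (A w) (br x y)"
    using inv'[of x y "A w"] sym by metis
  finally show ?thesis by simp
qed

section \<open>The extended quadratic Lie algebra\<close>

locale plane_extension =
  fixes br0 :: "'a::real_vector \<Rightarrow> 'a \<Rightarrow> 'a"
    and \<phi>0 :: "'a \<Rightarrow> 'a \<Rightarrow> real" and D F :: "'a \<Rightarrow> 'a" and s0 :: 'a
  assumes quad: "quadratic_lie_algebra br0 \<phi>0"
    and derD: "derivation br0 D" and skewD: "skewsymmetric_wrt \<phi>0 D"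
    and derF: "derivation br0 F" and skewF: "skewsymmetric_wrt \<phi>0 F"
    and comFD: "commutator F D = ad br0 s0"
begin

abbreviation "\<beta> \<equiv> ext_bracket br0 \<phi>0 D F s0"
abbreviation "\<Phi> \<equiv> ext_form \<phi>0"

lemma bil: "bilinear \<phi>0" and sym: "\<phi>0 x y = \<phi>0 y x"
  and bil_br: "bilinear br0" and br_skew: "br0 x y = - br0 y x"
  and jacobi: "br0 x (br0 y w) + br0 y (br0 w x) + br0 w (br0 x y) = 0"
  and invariant: "\<phi>0 (br0 x y) w + \<phi>0 y (br0 x w) = 0"
  and nondeg: "(\<And>y. \<phi>0 x y = 0) \<Longrightarrow> x = 0"
  using quad unfolding quadratic_lie_algebra_def lie_algebra_def nondegenerate_def by blast+

lemma linD: "linear D" and linF: "linear F"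
  and D_br: "D (br0 x y) = br0 (D x) y + br0 x (D y)"
  and F_br: "F (br0 x y) = br0 (F x) y + br0 x (F y)"
  and D_skew: "\<phi>0 (D x) y = - \<phi>0 x (D y)" and F_skew: "\<phi>0 (F x) y = - \<phi>0 x (F y)"
  using derD derF skewD skewF unfolding derivation_def skewsymmetric_wrt_def by blast+

lemma F_D: "F (D x) = D (F x) + br0 s0 x"
  using fun_cong[OF comFD, of x] by (simp add: commutator_def ad_def algebra_simps)

lemmas form_linear = bilinear_ladd[OF bil] bilinear_radd[OF bil] bilinear_lmul[OF bil]
  bilinear_rmul[OF bil] bilinear_lsub[OF bil] bilinear_rsub[OF bil]
  bilinear_lneg[OF bil] bilinear_rneg[OF bil]
lemmas br_linear = bilinear_ladd[OF bil_br] bilinear_radd[OF bil_br] bilinear_lmul[OF bil_br]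
  bilinear_rmul[OF bil_br] bilinear_lsub[OF bil_br] bilinear_rsub[OF bil_br]
lemmas D_linear = linear_add[OF linD] linear_scale[OF linD] linear_diff[OF linD]
lemmas F_linear = linear_add[OF linF] linear_scale[OF linF] linear_diff[OF linF]

lemma invariant_cyclic: "\<phi>0 (br0 x y) w = \<phi>0 x (br0 y w)"
  using invariant[of y x w] br_skew[of x y] by (simp add: form_linear)

text \<open>The identity \<open>[F, D] = ad s\<^sub>0\<close>, paired with an element and rewritten by skewsymmetry.\<close>

lemma form_F_D: "\<phi>0 (F x) (D y) - \<phi>0 (F y) (D x) = \<phi>0 s0 (br0 x y)"
proof -
  have "\<phi>0 (F x) (D y) = - \<phi>0 (D (F x)) y"
    by (simp add: D_skew)
  moreover have "\<phi>0 (F y) (D x) = - \<phi>0 (F (D x)) y"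
    by (metis F_skew sym)
  ultimately show ?thesis
    by (simp add: F_D form_linear invariant_cyclic)
qed

lemma bilinear_ext_bracket: "bilinear \<beta>" and ext_bracket_skew: "\<beta> X Y = - \<beta> Y X"
  using ext_bracket_characterization[OF quad skewD skewF, of \<beta>] by blast+

lemma bilinear_ext_form: "bilinear \<Phi>" and ext_form_sym: "\<Phi> X Y = \<Phi> Y X"
  using ext_form_characterization[OF bil sym, of \<Phi>] by blast+

lemma nondegenerate_ext_form: "nondegenerate \<Phi>"
  unfolding nondegenerate_def
proof (intro allI impI)
  fix X assume h: "\<forall>Y. \<Phi> X Y = 0"
  obtain a a' x b' b where X: "X = (a, a', x, b', b)" by (cases X) auto
  have "x = 0"
    using h[rule_format, of "(0, 0, y, 0, 0)" for y] by (intro nondeg) (simp add: X)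
  moreover have "a = 0" "a' = 0" "b' = 0" "b = 0"
    using h[rule_format, of "(0, 0, 0, 0, 1)"] h[rule_format, of "(0, 0, 0, 1, 0)"]
      h[rule_format, of "(0, 1, 0, 0, 0)"] h[rule_format, of "(1, 0, 0, 0, 0)"]
    by (simp_all add: X bilinear_rzero[OF bil])
  ultimately show "X = 0" by (simp add: X zero_prod_def)
qed

lemma ext_form_invariant: "\<Phi> (\<beta> X Y) W + \<Phi> Y (\<beta> X W) = 0"
proof -
  obtain a a' x b' b where X: "X = (a, a', x, b', b)" by (cases X) auto
  obtain c c' y d' d where Y: "Y = (c, c', y, d', d)" by (cases Y) auto
  obtain k k' w e' e where W: "W = (k, k', w, e', e)" by (cases W) auto
  show ?thesis
    using invariant[of x y w] F_skew[of y w] D_skew[of y w]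
      sym[of y "F x"] sym[of y "D x"] sym[of y s0]
    by (simp add: X Y W form_linear algebra_simps)
qed

lemma ext_bracket_jacobi: "\<beta> X (\<beta> Y W) + \<beta> Y (\<beta> W X) + \<beta> W (\<beta> X Y) = 0"
proof -
  obtain a a' x b' b where X: "X = (a, a', x, b', b)" by (cases X) auto
  obtain c c' y d' d where Y: "Y = (c, c', y, d', d)" by (cases Y) auto
  obtain k k' w e' e where W: "W = (k, k', w, e', e)" by (cases W) auto
  note cocycle = skew_derivation_cocycle[OF quad]
  note s0_sym = sym[of s0 "F x"] sym[of s0 "F y"] sym[of s0 "F w"]
    sym[of s0 "D x"] sym[of s0 "D y"] sym[of s0 "D w"]
  \<comment> \<open>The \<open>g\<^sub>0\<close>-coordinate of a bracket. It is all that matters of an inner bracket, since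
    \<open>z\<close> and \<open>z'\<close> are central and brackets have no \<open>v\<close>- or \<open>v'\<close>-coordinate.\<close>
  define u where "u = (\<lambda>x b' b y d' d. br0 x y + b *\<^sub>R F y - d *\<^sub>R F x + b' *\<^sub>R D y - d' *\<^sub>R D x
    + (b * d' - b' * d) *\<^sub>R s0)"
  have z: "(\<phi>0 (F x) (u y d' d w e' e) + b' * \<phi>0 s0 (u y d' d w e' e))
    + (\<phi>0 (F y) (u w e' e x b' b) + d' * \<phi>0 s0 (u w e' e x b' b))
    + (\<phi>0 (F w) (u x b' b y d' d) + e' * \<phi>0 s0 (u x b' b y d' d)) = 0"
  proof -
    \<comment> \<open>Only mixed terms with \<open>(x, w)\<close>, \<open>(w, y)\<close> or \<open>(y, x)\<close> in \<open>F\<close>, \<open>D\<close> survive the rewriting,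
      so that they cancel; what is left over cancels against the terms \<open>\<phi>\<^sub>0(s\<^sub>0, [_, _])\<close>.\<close>
    have 1: "\<phi>0 (F x) (D y) = \<phi>0 (F y) (D x) + \<phi>0 s0 (br0 x y)"
       "\<phi>0 (F y) (D w) = \<phi>0 (F w) (D y) + \<phi>0 s0 (br0 y w)"
       "\<phi>0 (F w) (D x) = \<phi>0 (F x) (D w) + \<phi>0 s0 (br0 w x)"
      using form_F_D[of x y] form_F_D[of y w] form_F_D[of w x] by simp_all
    show ?thesis
      using cocycle[OF derF skewF, of x y w]
      by (simp add: u_def form_linear 1 s0_sym sym[of "F y" "F x"] sym[of "F w" "F x"]
          sym[of "F w" "F y"] algebra_simps)
  qed
  have z': "(\<phi>0 (D x) (u y d' d w e' e) - b * \<phi>0 s0 (u y d' d w e' e))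
    + (\<phi>0 (D y) (u w e' e x b' b) - d * \<phi>0 s0 (u w e' e x b' b))
    + (\<phi>0 (D w) (u x b' b y d' d) - e * \<phi>0 s0 (u x b' b y d' d)) = 0"
  proof -
    have 1: "\<phi>0 (D y) (F x) = \<phi>0 (D x) (F y) + \<phi>0 s0 (br0 x y)"
       "\<phi>0 (D w) (F y) = \<phi>0 (D y) (F w) + \<phi>0 s0 (br0 y w)"
       "\<phi>0 (D x) (F w) = \<phi>0 (D w) (F x) + \<phi>0 s0 (br0 w x)"
      using form_F_D[of x y] form_F_D[of y w] form_F_D[of w x] sym by (metis diff_eq_eq add.commute)+
    show ?thesis
      using cocycle[OF derD skewD, of x y w]
      by (simp add: u_def form_linear 1 s0_sym sym[of "D y" "D x"] sym[of "D w" "D x"]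
          sym[of "D w" "D y"] algebra_simps)
  qed
  have g0: "(br0 x (u y d' d w e' e) + b *\<^sub>R F (u y d' d w e' e) + b' *\<^sub>R D (u y d' d w e' e))
    + (br0 y (u w e' e x b' b) + d *\<^sub>R F (u w e' e x b' b) + d' *\<^sub>R D (u w e' e x b' b))
    + (br0 w (u x b' b y d' d) + e *\<^sub>R F (u x b' b y d' d) + e' *\<^sub>R D (u x b' b y d' d)) = 0"
  proof -
    \<comment> \<open>Oriented so as to eliminate one of the three double brackets.\<close>
    have J: "br0 x (br0 y w) = - br0 y (br0 w x) - br0 w (br0 x y)"
      using jacobi[of x y w]
      by (simp only: diff_conv_add_uminus minus_add_distrib[symmetric] eq_neg_iff_add_eq_0 add.assoc)
    show ?thesis
      by (simp add: u_def br_linear F_linear D_linear F_br D_br F_D J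
          br_skew[of "F x"] br_skew[of "F y"] br_skew[of "F w"]
          br_skew[of "D x"] br_skew[of "D y"] br_skew[of "D w"] br_skew[of s0] algebra_simps)
  qed
  show ?thesis
    using z z' g0 by (simp add: X Y W u_def zero_prod_def)
qed

lemma quadratic_lie_algebra_ext: "quadratic_lie_algebra \<beta> \<Phi>"
  unfolding quadratic_lie_algebra_def lie_algebra_def
  using bilinear_ext_bracket ext_bracket_skew ext_bracket_jacobi bilinear_ext_form ext_form_sym
    nondegenerate_ext_form ext_form_invariant by blast

end

section \<open>The complex structure\<close>

locale hermitian_plane_extension = plane_extension br0 \<phi>0 D F s0
  for br0 :: "'a::real_vector \<Rightarrow> 'a \<Rightarrow> 'a" and \<phi>0 D F s0 +
  fixes J0 :: "'a \<Rightarrow> 'a"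
  assumes cplx: "complex_structure br0 J0"
    and hermitian: "\<phi>0 (J0 x) (J0 y) = \<phi>0 x y"
    and comJ: "commutator (\<lambda>x. F x + J0 (D x)) J0 = (\<lambda>x. 0)"
begin

abbreviation "\<J> \<equiv> ext_J J0"

lemma linJ: "linear J0" and J_J: "J0 (J0 x) = - x"
  and Nijenhuis: "br0 x y + J0 (br0 (J0 x) y) + J0 (br0 x (J0 y)) - br0 (J0 x) (J0 y) = 0"
  using cplx unfolding complex_structure_def by blast+

lemmas J_linear = linear_add[OF linJ] linear_scale[OF linJ] linear_diff[OF linJ] linear_neg[OF linJ]

lemma J_skew: "\<phi>0 (J0 x) y = - \<phi>0 x (J0 y)"
  using hermitian[of x "J0 y"] by (simp add: J_J form_linear)

lemma J_commutation: "F (J0 x) + J0 (D (J0 x)) = J0 (F x) - D x"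
  using fun_cong[OF comJ, of x] by (simp add: commutator_def J_linear J_J)

text \<open>
  The left-hand sides are the \<open>z'\<close>- and \<open>z\<close>-coordinates of the Nijenhuis expression of two
  elements of \<open>g\<^sub>0\<close>. The first is \<open>\<phi>\<^sub>0\<close> of \<open>F J\<^sub>0 x + J\<^sub>0 D J\<^sub>0 x - J\<^sub>0 F x + D x\<close> and \<open>y\<close>, because
  \<open>J\<^sub>0\<close> is skewsymmetric.
\<close>

lemma form_Nijenhuis:
  "\<phi>0 (D x) y + \<phi>0 (F (J0 x)) y + \<phi>0 (F x) (J0 y) - \<phi>0 (D (J0 x)) (J0 y) = 0"
  "\<phi>0 (F x) y - \<phi>0 (D (J0 x)) y - \<phi>0 (D x) (J0 y) - \<phi>0 (F (J0 x)) (J0 y) = 0"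
proof -
  have J: "\<phi>0 x (J0 y) = - \<phi>0 (J0 x) y" for x y by (simp add: J_skew)
  show *: "\<phi>0 (D x) y + \<phi>0 (F (J0 x)) y + \<phi>0 (F x) (J0 y) - \<phi>0 (D (J0 x)) (J0 y) = 0" for y
    using arg_cong[OF J_commutation[of x], of "\<lambda>t. \<phi>0 t y"] by (simp add: J form_linear)
  \<comment> \<open>Replacing \<open>y\<close> by \<open>J\<^sub>0 y\<close> interchanges the two coordinates up to sign.\<close>
  show "\<phi>0 (F x) y - \<phi>0 (D (J0 x)) y - \<phi>0 (D x) (J0 y) - \<phi>0 (F (J0 x)) (J0 y) = 0"
    using *[of "J0 y"] by (simp add: J_J form_linear)
qed

lemma ext_Nijenhuis: "\<beta> X Y + \<J> (\<beta> (\<J> X) Y) + \<J> (\<beta> X (\<J> Y)) - \<beta> (\<J> X) (\<J> Y) = 0"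
proof -
  obtain a a' x b' b where X: "X = (a, a', x, b', b)" by (cases X) auto
  obtain c c' y d' d where Y: "Y = (c, c', y, d', d)" by (cases Y) auto
  \<comment> \<open>Oriented so as to eliminate \<open>F \<circ> J\<^sub>0\<close>, which leaves only terms that cancel formally.\<close>
  have FJ: "F (J0 x) = J0 (F x) - D x - J0 (D (J0 x))" for x
    using J_commutation[of x] by (simp add: algebra_simps)
  have N: "br0 x y = br0 (J0 x) (J0 y) - J0 (br0 (J0 x) y) - J0 (br0 x (J0 y))"
    using Nijenhuis[of x y] by (simp add: algebra_simps add_eq_0_iff2)
  show ?thesis
    using form_Nijenhuis[of x y]
    by (simp add: X Y zero_prod_def J_linear J_J FJ N algebra_simps)
qed

lemma complex_structure_ext: "complex_structure \<beta> \<J>"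
  unfolding complex_structure_def
proof (intro conjI allI ext_Nijenhuis)
  show "linear \<J>"
    using ext_J_characterization[OF linJ, of \<J>] by blast
  show "\<J> (\<J> X) = - X" for X
    by (cases X) (auto simp: J_J)
qed

lemma ext_form_hermitian: "\<Phi> (\<J> X) (\<J> Y) = \<Phi> X Y"
  by (cases X; cases Y) (auto simp: hermitian)

end

theorem proposition2p2:
  fixes br0 :: "'a::real_vector \<Rightarrow> 'a \<Rightarrow> 'a"
    and J0 D F :: "'a \<Rightarrow> 'a"
    and \<phi>0 :: "'a \<Rightarrow> 'a \<Rightarrow> real"
    and s0 :: 'a
  assumes "pseudo_hermitian_quadratic_lie_algebra br0 J0 \<phi>0"
    and "derivation br0 D" and "skewsymmetric_wrt \<phi>0 D"
    and "derivation br0 F" and "skewsymmetric_wrt \<phi>0 F"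
    and "commutator (\<lambda>x. F x + J0 (D x)) J0 = (\<lambda>x. 0)"
    and "commutator F D = ad br0 s0"
  shows "quadratic_lie_algebra (ext_bracket br0 \<phi>0 D F s0) (ext_form \<phi>0)
    \<and> complex_structure (ext_bracket br0 \<phi>0 D F s0) (ext_J J0)
    \<and> (\<forall>X Y. ext_form \<phi>0 (ext_J J0 X) (ext_J J0 Y) = ext_form \<phi>0 X Y)"
proof -
  interpret hermitian_plane_extension br0 \<phi>0 D F s0 J0
    by unfold_locales
      (use assms in \<open>auto simp: pseudo_hermitian_quadratic_lie_algebra_def\<close>)
  show ?thesis
    using quadratic_lie_algebra_ext complex_structure_ext ext_form_hermitian by blast
qed

end
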